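(* Every $\Sigma$-formula $\phi$ is $\mathfrak{F}$-equivalent to an $\mathcal{L}_{BT}$-formula of the form $(\exists v_0)(Q_1v_1\sqsubseteq t_1)\cdots(Q_mv_m\sqsubseteq t_m)\,s=t$, where $s,t,t_1,\ldots,t_m$ are terms and $Q_j\in\{\exists,\forall\}$ for $j=1,\ldots,m$. Moreover, if $\phi$ is purely existential, then $\phi$ is $\mathfrak{F}$-equivalent to a formula of the form $\exists v_0\ldots v_m[v_1\sqsubseteq t_1\wedge\cdots\wedge v_m\sqsubseteq t_m\wedge s=t]$.
   Context: Bit strings are elements of $\{\mathbf{0},\mathbf{1}\}^*$; $\varepsilon$ is the empty string, $|\alpha|$ the length. The language $\mathcal{L}_{BT}$ has constant symbols $e,0,1$, binary function symbol $\circ$, and binary relation symbol $\sqsubseteq$. The structure $\mathfrak{F}$ has universe $\{\mathbf{0},\mathbf{1}\}^*$, interprets $e,0,1$ as $\varepsilon,\mathbf{0},\mathbf{1}$, $\circ$ as concatenation, and $\alpha\sqsubseteq\beta$ as $|\alpha|\le|\beta|$. $(\exists x\sqsubseteq t)\phi$ abbreviates $\exists x[x\sqsubseteq t\wedge\phi]$, $(\forall x\sqsubseteq t)\phi$ abbreviates $\forall x[x\sqsubseteq t\to\phi]$. $\Sigma$-formulas: $s\sqsubseteq t$, $\neg s\sqsubseteq t$, $s=t$, $\neg s=t$ (terms $s,t$) are $\Sigma$-formulas; they are closed under $\wedge,\vee$, and under $(\exists x\sqsubseteq t)$, $(\forall x\sqsubseteq t)$ and $\exists x$ where $x$ does not occur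 in $t$. A purely existential formula is a $\Sigma$-formula with no bounded universal quantifiers. Two formulas are $\mathfrak{F}$-equivalent if their biconditional (universally closed) holds in $\mathfrak{F}$. *)

theory Defs
  imports Main
begin

text \<open>Bit strings; \<^const>\<open>False\<close> is the bit 0 and \<^const>\<open>True\<close> is the bit 1.\<close>

type_synonym bitstring = "bool list"

datatype tm =
    Var nat
  | EmptyC
  | ZeroC
  | OneC
  | Comp tm tm

datatype fm =
    Eq tm tm
  | Le tm tm
  | Neg fm
  | Conj fm fm
  | Disj fm fm
  | Imp fm fm
  | Ex nat fm
  | All nat fm

definition Iff :: "fm \<Rightarrow> fm \<Rightarrow> fm" where
  "Iff \<phi> \<psi> = Conj (Imp \<phi> \<psi>) (Imp \<psi> \<phi>)"

definition BEx :: "nat \<Rightarrow> tm \<Rightarrow> fm \<Rightarrow> fm" where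
  "BEx x t \<phi> = Ex x (Conj (Le (Var x) t) \<phi>)"

definition BAll :: "nat \<Rightarrow> tm \<Rightarrow> fm \<Rightarrow> fm" where
  "BAll x t \<phi> = All x (Imp (Le (Var x) t) \<phi>)"

fun vars :: "tm \<Rightarrow> nat set" where
  "vars (Var x) = {x}"
| "vars EmptyC = {}"
| "vars ZeroC = {}"
| "vars OneC = {}"
| "vars (Comp s t) = vars s \<union> vars t"

fun subformulas :: "fm \<Rightarrow> fm set" where
  "subformulas (Eq s t) = {Eq s t}"
| "subformulas (Le s t) = {Le s t}"
| "subformulas (Neg \<phi>) = insert (Neg \<phi>) (subformulas \<phi>)"
| "subformulas (Conj \<phi> \<psi>) = insert (Conj \<phi> \<psi>) (subformulas \<phi> \<union> subformulas \<psi>)"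
| "subformulas (Disj \<phi> \<psi>) = insert (Disj \<phi> \<psi>) (subformulas \<phi> \<union> subformulas \<psi>)"
| "subformulas (Imp \<phi> \<psi>) = insert (Imp \<phi> \<psi>) (subformulas \<phi> \<union> subformulas \<psi>)"
| "subformulas (Ex x \<phi>) = insert (Ex x \<phi>) (subformulas \<phi>)"
| "subformulas (All x \<phi>) = insert (All x \<phi>) (subformulas \<phi>)"

text \<open>Evaluation and satisfaction in the structure of all bit strings, where the relation
  symbol compares lengths (it is not the prefix or substring relation).\<close>

fun eval :: "(nat \<Rightarrow> bitstring) \<Rightarrow> tm \<Rightarrow> bitstring" where
  "eval \<rho> (Var x) = \<rho> x"
| "eval \<rho> EmptyC = []"
| "eval \<rho> ZeroC = [False]"
| "eval \<rho> OneC = [True]"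
| "eval \<rho> (Comp s t) = eval \<rho> s @ eval \<rho> t"

fun sat :: "(nat \<Rightarrow> bitstring) \<Rightarrow> fm \<Rightarrow> bool" where
  "sat \<rho> (Eq s t) \<longleftrightarrow> eval \<rho> s = eval \<rho> t"
| "sat \<rho> (Le s t) \<longleftrightarrow> length (eval \<rho> s) \<le> length (eval \<rho> t)"
| "sat \<rho> (Neg \<phi>) \<longleftrightarrow> \<not> sat \<rho> \<phi>"
| "sat \<rho> (Conj \<phi> \<psi>) \<longleftrightarrow> sat \<rho> \<phi> \<and> sat \<rho> \<psi>"
| "sat \<rho> (Disj \<phi> \<psi>) \<longleftrightarrow> sat \<rho> \<phi> \<or> sat \<rho> \<psi>"
| "sat \<rho> (Imp \<phi> \<psi>) \<longleftrightarrow> (sat \<rho> \<phi> \<longrightarrow> sat \<rho> \<psi>)"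
| "sat \<rho> (Ex x \<phi>) \<longleftrightarrow> (\<exists>\<alpha>. sat (\<rho>(x := \<alpha>)) \<phi>)"
| "sat \<rho> (All x \<phi>) \<longleftrightarrow> (\<forall>\<alpha>. sat (\<rho>(x := \<alpha>)) \<phi>)"

text \<open>Quantifying over all assignments amounts to taking the universal closure.\<close>

definition equiv_F :: "fm \<Rightarrow> fm \<Rightarrow> bool" where
  "equiv_F \<phi> \<psi> \<longleftrightarrow> (\<forall>\<rho>. sat \<rho> (Iff \<phi> \<psi>))"

inductive Sigma_fm :: "fm \<Rightarrow> bool" where
  Le: "Sigma_fm (Le s t)"
| Neg_Le: "Sigma_fm (Neg (Le s t))"
| Eq: "Sigma_fm (Eq s t)"
| Neg_Eq: "Sigma_fm (Neg (Eq s t))"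
| Conj: "Sigma_fm \<phi> \<Longrightarrow> Sigma_fm \<psi> \<Longrightarrow> Sigma_fm (Conj \<phi> \<psi>)"
| Disj: "Sigma_fm \<phi> \<Longrightarrow> Sigma_fm \<psi> \<Longrightarrow> Sigma_fm (Disj \<phi> \<psi>)"
| BEx: "Sigma_fm \<phi> \<Longrightarrow> x \<notin> vars t \<Longrightarrow> Sigma_fm (BEx x t \<phi>)"
| BAll: "Sigma_fm \<phi> \<Longrightarrow> x \<notin> vars t \<Longrightarrow> Sigma_fm (BAll x t \<phi>)"
| Ex: "Sigma_fm \<phi> \<Longrightarrow> Sigma_fm (Ex x \<phi>)"

definition purely_existential :: "fm \<Rightarrow> bool" where
  "purely_existential \<phi> \<longleftrightarrow> Sigma_fm \<phi> \<and> (\<forall>x t \<psi>. BAll x t \<psi> \<notin> subformulas \<phi>)"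

datatype quant = Exists | Forall

fun bquant :: "quant \<times> nat \<times> tm \<Rightarrow> fm \<Rightarrow> fm" where
  "bquant (Exists, x, t) \<phi> = BEx x t \<phi>"
| "bquant (Forall, x, t) \<phi> = BAll x t \<phi>"

text \<open>In both forms below the variables are pairwise distinct, and a bounding term
  does not contain the variable that it bounds. The list of bounds may be empty.\<close>

definition bounded_prefix_form :: "fm \<Rightarrow> bool" where
  "bounded_prefix_form \<psi> \<longleftrightarrow>
    (\<exists>v\<^sub>0 qs s t.
      distinct (v\<^sub>0 # map (\<lambda>(Q, v, u). v) qs) \<and>
      (\<forall>(Q, v, u) \<in> set qs. v \<notin> vars u) \<and>
      \<psi> = Ex v\<^sub>0 (foldr bquant qs (Eq s t)))"

definition existential_form :: "fm \<Rightarrow> bool" where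
  "existential_form \<psi> \<longleftrightarrow>
    (\<exists>v\<^sub>0 bs s t.
      distinct (v\<^sub>0 # map fst bs) \<and>
      (\<forall>(v, u) \<in> set bs. v \<notin> vars u) \<and>
      \<psi> = foldr Ex (v\<^sub>0 # map fst bs)
            (foldr Conj (map (\<lambda>(v, u). Le (Var v) u) bs) (Eq s t)))"

end

theory Submission imports Defs begin

text \<open>Conjunctions of equations merge into one equation by
  \<open>a = b \<and> c = d \<longleftrightarrow> a0ca1c = b0db1d\<close>. For a disjunction \<open>a = b \<or> c = d\<close>, choose
  \<open>X \<in> 0\<^sup>*\<close> and \<open>Y \<in> 1\<^sup>*\<close> with \<open>XY = YX\<close>, so that one of them is empty, and require \<open>ap = qb\<close> and
  \<open>cp' = q'd\<close> with \<open>p, q \<sqsubseteq> X\<close> and \<open>p', q' \<sqsubseteq> Y\<close>: an empty bound forces the equation, and a long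
  one makes it solvable by \<open>p = b\<close>, \<open>q = a\<close>.

  There is a single unbounded quantifier \<open>\<exists>z\<close> throughout because the matrix below it is kept monotone
  in the length of \<open>z\<close>: existential witnesses are bounded by \<open>z\<close>, and \<open>\<exists>z\<close> moves across a bounded
  universal quantifier because there are only finitely many strings of bounded length.\<close>

subsection \<open>Dependence on variables\<close>

lemma finite_vars [simp]: "finite (vars t)"
  by (induction t) auto

lemma eval_cong: "(\<And>x. x \<in> vars t \<Longrightarrow> \<rho> x = \<rho>' x) \<Longrightarrow> eval \<rho> t = eval \<rho>' t"
  by (induction t) auto

lemma eval_upd [simp]: "x \<notin> vars t \<Longrightarrow> eval (\<rho>(x := \<alpha>)) t = eval \<rho> t"
  by (rule eval_cong) auto

text \<open>A semantic stand-in for free variables: it transfers along equivalences, so merged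
  matrices need no syntactic computation.\<close>

definition supported :: "nat set \<Rightarrow> fm \<Rightarrow> bool" where
  "supported V \<phi> \<longleftrightarrow> (\<forall>\<rho> \<rho>'. (\<forall>x\<in>V. \<rho> x = \<rho>' x) \<longrightarrow> sat \<rho> \<phi> = sat \<rho>' \<phi>)"

lemma supportedD: "supported V \<phi> \<Longrightarrow> (\<And>x. x \<in> V \<Longrightarrow> \<rho> x = \<rho>' x) \<Longrightarrow> sat \<rho> \<phi> = sat \<rho>' \<phi>"
  by (auto simp: supported_def)

lemma supported_upd: "supported V \<phi> \<Longrightarrow> x \<notin> V \<Longrightarrow> sat (\<rho>(x := \<alpha>)) \<phi> = sat \<rho> \<phi>"
  by (erule supportedD) auto

definition length_mono :: "nat \<Rightarrow> fm \<Rightarrow> bool" where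
  "length_mono z \<phi> \<longleftrightarrow> (\<forall>\<rho> \<zeta> \<zeta>'. length \<zeta> \<le> length \<zeta>' \<longrightarrow> sat (\<rho>(z := \<zeta>)) \<phi> \<longrightarrow> sat (\<rho>(z := \<zeta>')) \<phi>)"

lemma length_monoD:
  "length_mono z \<phi> \<Longrightarrow> sat (\<rho>(z := \<zeta>)) \<phi> \<Longrightarrow> length \<zeta> \<le> length \<zeta>' \<Longrightarrow> sat (\<rho>(z := \<zeta>')) \<phi>"
  by (auto simp: length_mono_def)

subsection \<open>Quantifier prefixes\<close>

type_synonym qprefix = "(quant \<times> nat \<times> tm) list"

text \<open>Besides avoiding \<open>F\<close>, the bound variables are distinct, and none occurs in a bound at or before
  its own position.\<close>

fun fresh :: "nat set \<Rightarrow> qprefix \<Rightarrow> bool" where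
  "fresh F [] \<longleftrightarrow> True"
| "fresh F ((Q, v, u) # qs) \<longleftrightarrow> v \<notin> F \<union> vars u \<and> fresh (insert v (F \<union> vars u)) qs"

fun qvars :: "qprefix \<Rightarrow> nat set" where
  "qvars [] = {}"
| "qvars ((Q, v, u) # qs) = insert v (vars u \<union> qvars qs)"

abbreviation bvars :: "qprefix \<Rightarrow> nat list" where
  "bvars qs \<equiv> map (\<lambda>(Q, v, u). v) qs"

lemma finite_qvars [simp]: "finite (qvars qs)"
  by (induction qs rule: qvars.induct) auto

lemma fresh_antimono: "fresh F qs \<Longrightarrow> G \<subseteq> F \<Longrightarrow> fresh G qs"
proof (induction F qs arbitrary: G rule: fresh.induct)
  case (2 F Q v u qs)
  have "insert v (G \<union> vars u) \<subseteq> insert v (F \<union> vars u)" using "2.prems"(2) by blast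
  then show ?case using 2 by auto
qed simp

text \<open>Having run through \<open>ps\<close>, \<open>fresh\<close> has accumulated
  \<open>F \<union> qvars ps\<close>, so freshness over any larger \<open>G\<close> suffices for the
  rest.\<close>

lemma fresh_append:
  "fresh F ps \<Longrightarrow> fresh G qs \<Longrightarrow> F \<union> qvars ps \<subseteq> G \<Longrightarrow> fresh F (ps @ qs)"
  by (induction F ps rule: fresh.induct) (auto elim: fresh_antimono)

lemma fresh_disjoint: "fresh F qs \<Longrightarrow> set (bvars qs) \<inter> F = {}"
  by (induction F qs rule: fresh.induct) auto

lemma fresh_distinct: "fresh F qs \<Longrightarrow> distinct (bvars qs)"
proof (induction F qs rule: fresh.induct)
  case (2 F Q v u qs)
  then show ?case using fresh_disjoint[of "insert v (F \<union> vars u)" qs] by auto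
qed simp

lemma fresh_bound: "fresh F qs \<Longrightarrow> (Q, v, u) \<in> set qs \<Longrightarrow> v \<notin> vars u"
  by (induction F qs rule: fresh.induct) auto

lemma sat_BEx [simp]: "x \<notin> vars t \<Longrightarrow>
    sat \<rho> (BEx x t \<phi>) \<longleftrightarrow> (\<exists>\<alpha>. length \<alpha> \<le> length (eval \<rho> t) \<and> sat (\<rho>(x := \<alpha>)) \<phi>)"
  by (simp add: BEx_def)

lemma sat_BAll [simp]: "x \<notin> vars t \<Longrightarrow>
    sat \<rho> (BAll x t \<phi>) \<longleftrightarrow> (\<forall>\<alpha>. length \<alpha> \<le> length (eval \<rho> t) \<longrightarrow> sat (\<rho>(x := \<alpha>)) \<phi>)"
  by (simp add: BAll_def)

lemma sat_bquant_cong: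
  "(\<And>\<rho>. sat \<rho> \<phi> = sat \<rho> \<psi>) \<Longrightarrow> sat \<rho> (bquant q \<phi>) = sat \<rho> (bquant q \<psi>)"
  by (cases "(q, \<phi>)" rule: bquant.cases) (auto simp: BEx_def BAll_def)

lemma sat_prefix_cong:
  "(\<And>\<rho>. sat \<rho> \<phi> = sat \<rho> \<psi>) \<Longrightarrow> sat \<rho> (foldr bquant qs \<phi>) = sat \<rho> (foldr bquant qs \<psi>)"
proof (induction qs arbitrary: \<rho>)
  case (Cons q qs)
  then show ?case using sat_bquant_cong[of "foldr bquant qs \<phi>" "foldr bquant qs \<psi>"] by simp
qed simp

text \<open>Pulling a quantifier out of a disjunction uses that the range of a bounded quantifier is never
  empty, as it contains the empty string.\<close>

lemma sat_prefix_pull: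
  assumes "h = Conj \<or> h = Disj" "fresh F qs" "supported F \<psi>"
  shows "sat \<rho> (foldr bquant qs (h \<phi> \<psi>)) \<longleftrightarrow> sat \<rho> (h (foldr bquant qs \<phi>) \<psi>)"
  using assms(2,3)
proof (induction F qs arbitrary: \<rho> rule: fresh.induct)
  case (2 F Q v u qs)
  have supp: "supported (insert v (F \<union> vars u)) \<psi>"
    using "2.prems"(2) by (auto simp: supported_def)
  note [simp] = supported_upd[OF "2.prems"(2)]
  have ne: "\<exists>\<alpha>. length \<alpha> \<le> n" for n :: nat
    by (rule exI[of _ "[]"]) simp
  have IH: "sat \<rho> (foldr bquant qs (h \<phi> \<psi>)) \<longleftrightarrow> sat \<rho> (h (foldr bquant qs \<phi>) \<psi>)" for \<rho>
    using "2.IH" "2.prems"(1) supp by simp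
  show ?case
    using "2.prems"(1) assms(1) ne[of "length (eval \<rho> u)"] by (cases Q) (auto simp: IH)
qed simp

subsection \<open>Renaming a variable that is not bound by the prefix\<close>

fun rename :: "nat \<Rightarrow> nat \<Rightarrow> tm \<Rightarrow> tm" where
  "rename x y (Var v) = Var (if v = x then y else v)"
| "rename x y (Comp s t) = Comp (rename x y s) (rename x y t)"
| "rename x y t = t"

lemma eval_rename [simp]: "eval \<rho> (rename x y t) = eval (\<rho>(x := \<rho> y)) t"
  by (induction t) auto

lemma vars_rename: "vars (rename x y t) \<subseteq> insert y (vars t)"
  by (induction t) auto

abbreviation rename_prefix :: "nat \<Rightarrow> nat \<Rightarrow> qprefix \<Rightarrow> qprefix" where
  "rename_prefix x y \<equiv> map (\<lambda>(Q, v, u). (Q, v, rename x y u))"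

lemma fresh_rename: "fresh F qs \<Longrightarrow> y \<in> F \<Longrightarrow> fresh F (rename_prefix x y qs)"
proof (induction F qs rule: fresh.induct)
  case (2 F Q v u qs)
  have "insert v (F \<union> vars (rename x y u)) \<subseteq> insert v (F \<union> vars u)"
    using "2.prems"(2) vars_rename[of x y u] by auto
  then have "fresh (insert v (F \<union> vars (rename x y u))) (rename_prefix x y qs)"
    using 2 by (auto elim: fresh_antimono)
  then show ?case using 2 vars_rename[of x y u] by auto
qed simp

text \<open>Substitution lemma for prefixes: as \<open>x\<close> and \<open>y\<close> lie in
  \<open>F\<close>, no quantifier of \<open>qs\<close> rebinds \<open>x\<close> or captures
  \<open>y\<close>.\<close>

lemma sat_rename:
  "fresh F qs \<Longrightarrow> x \<in> F \<Longrightarrow> y \<in> F \<Longrightarrow>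
    sat \<rho> (foldr bquant (rename_prefix x y qs) (Eq (rename x y s) (rename x y t)))
    \<longleftrightarrow> sat (\<rho>(x := \<rho> y)) (foldr bquant qs (Eq s t))"
proof (induction F qs arbitrary: \<rho> rule: fresh.induct)
  case (2 F Q v u qs)
  have v: "v \<notin> vars (rename x y u)" "v \<noteq> x" "v \<noteq> y"
    using 2 vars_rename[of x y u] by auto
  have upd: "(\<rho>(v := \<alpha>))(x := (\<rho>(v := \<alpha>)) y) = (\<rho>(x := \<rho> y))(v := \<alpha>)" for \<alpha>
    using v by (simp add: fun_upd_twist)
  have IH: "sat (\<rho>(v := \<alpha>)) (foldr bquant (rename_prefix x y qs) (Eq (rename x y s) (rename x y t)))
      \<longleftrightarrow> sat (\<rho>(x := \<rho> y, v := \<alpha>)) (foldr bquant qs (Eq s t))" for \<alpha>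
    unfolding upd[symmetric] by (rule "2.IH") (use "2.prems" in auto)
  show ?case
    using "2.prems"(1) v by (cases Q) (simp_all add: IH[unfolded fun_upd_def] fun_upd_def)
qed simp

subsection \<open>Boolean combinations of equations\<close>

text \<open>Each side consists of two halves of equal length, so the equation splits in the middle.
  If \<open>a\<close> were shorter than \<open>b\<close>, position \<open>length a\<close> would
  hold 0 in one half and 1 in the other, although both halves of the right side show the same letter
  of \<open>b\<close> there.\<close>

lemma conj_eq_append:
  "a @ [False] @ c @ a @ [True] @ c = b @ [False] @ d @ b @ [True] @ d \<longleftrightarrow> a = b \<and> c = d"
  (is "?l \<longleftrightarrow> ?r")
proof
  assume l: ?l
  then have "length (a @ [False] @ c @ a @ [True] @ c) = length (b @ [False] @ d @ b @ [True] @ d)"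
    by (rule arg_cong)
  then have "length (a @ [False] @ c) = length (b @ [False] @ d)" by simp
  then have h: "a @ [False] @ c = b @ [False] @ d" "a @ [True] @ c = b @ [True] @ d"
    using l append_eq_append_conv[of "a @ [False] @ c" "b @ [False] @ d" "a @ [True] @ c" "b @ [True] @ d"]
    by auto
  have "length a = length b"
  proof (rule ccontr)
    assume "length a \<noteq> length b"
    then consider "length a < length b" | "length b < length a" by linarith
    then show False
    proof cases
      case 1
      then show ?thesis
        using arg_cong[OF h(1), of "\<lambda>w. w ! length a"] arg_cong[OF h(2), of "\<lambda>w. w ! length a"]
        by (simp add: nth_append)
    next
      case 2
      then show ?thesis
        using arg_cong[OF h(1), of "\<lambda>w. w ! length b"] arg_cong[OF h(2), of "\<lambda>w. w ! length b"]
        by (simp add: nth_append)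
    qed
  qed
  then show ?r using h by simp
qed simp

text \<open>Nesting this term on both sides merges any number of equations into one.\<close>

definition pair_tm :: "tm \<Rightarrow> tm \<Rightarrow> tm" where
  "pair_tm a c = Comp a (Comp ZeroC (Comp c (Comp a (Comp OneC c))))"

lemma eval_pair_tm [simp]:
  "eval \<rho> (pair_tm a c) = eval \<rho> (pair_tm b d) \<longleftrightarrow> eval \<rho> a = eval \<rho> b \<and> eval \<rho> c = eval \<rho> d"
  using conj_eq_append[of "eval \<rho> a" "eval \<rho> c" "eval \<rho> b" "eval \<rho> d"] by (simp add: pair_tm_def)

text \<open>A nonempty \<open>X\<close> must begin with \<open>a\<close>, and its tail again
  commutes with \<open>a\<close>.\<close>

lemma commutes_letter: "X @ [a] = a # X \<Longrightarrow> set X \<subseteq> {a}"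
  by (induction X) auto

lemma disj_append_iff:
  assumes "length a + length b + length c + length d \<le> n"
  shows "a = b \<or> c = d \<longleftrightarrow>
    (\<exists>X Y p q p' q'. length X \<le> n \<and> length Y \<le> n \<and> length p \<le> length X \<and> length q \<le> length X \<and>
      length p' \<le> length Y \<and> length q' \<le> length Y \<and>
      X @ [False] = False # X \<and> Y @ [True] = True # Y \<and> X @ Y = Y @ X \<and>
      a @ p = q @ b \<and> c @ p' = q' @ d)" (is "_ \<longleftrightarrow> ?r")
proof
  assume "a = b \<or> c = d"
  then show ?r
  proof
    assume "a = b"
    then show ?r
      using assms
      \<comment> \<open>Backtracking distributes these values: \<open>X\<close>, \<open>p\<close>,
        \<open>q\<close> are empty, \<open>Y\<close> has length \<open>n\<close>, and
        \<open>p' = d\<close>, \<open>q' = c\<close> solve the second equation.\<close>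
      by (intro exI[of _ "[]"] exI[of _ "replicate n True"] exI[of _ d] exI[of _ c] conjI)
        (auto simp: replicate_append_same)
  next
    assume "c = d"
    then show ?r
      using assms
      by (intro exI[of _ "replicate n False"] exI[of _ "[]"] exI[of _ b] exI[of _ a] conjI)
        (auto simp: replicate_append_same)
  qed
next
  assume ?r
  then obtain X Y p q p' q' where *: "length p \<le> length X" "length q \<le> length X"
      "length p' \<le> length Y" "length q' \<le> length Y" "X @ [False] = False # X" "Y @ [True] = True # Y"
      "X @ Y = Y @ X" "a @ p = q @ b" "c @ p' = q' @ d" by auto
  have "set X \<subseteq> {False}" "set Y \<subseteq> {True}"
    using commutes_letter[OF *(5)] commutes_letter[OF *(6)] by auto
  \<comment> \<open>If both were nonempty, \<open>X @ Y\<close> would begin with 0 and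
    \<open>Y @ X\<close> with 1.\<close>
  then have "X = [] \<or> Y = []" using \<open>X @ Y = Y @ X\<close> by (cases X; cases Y) auto
  then show "a = b \<or> c = d" using * by auto
qed

lemma fresh_variables_exist:
  assumes "finite (F :: nat set)"
  shows "\<exists>v :: nat \<Rightarrow> nat. inj v \<and> range v \<inter> F = {}"
proof -
  obtain n where "\<And>x. x \<in> F \<Longrightarrow> x < n"
    using assms finite_nat_set_iff_bounded by auto
  then have "range (\<lambda>k. n + k) \<inter> F = {}" by fastforce
  moreover have "inj (\<lambda>k. n + k)" by (auto intro: injI)
  ultimately show ?thesis by blast
qed

lemma combine_equations:
  assumes "h = Conj \<or> h = Disj" "finite F"
  obtains ds s t where "fresh F ds" "\<forall>q\<in>set ds. fst q = Exists"
    "\<And>\<rho>. sat \<rho> (foldr bquant ds (Eq s t)) \<longleftrightarrow> sat \<rho> (h (Eq a b) (Eq c d))"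
  using assms(1)
proof
  assume "h = Conj"
  then show thesis by (intro that[of "[]" "pair_tm a c" "pair_tm b d"]) auto
next
  assume h: "h = Disj"
  have "finite (F \<union> vars a \<union> vars b \<union> vars c \<union> vars d)" using assms by simp
  from fresh_variables_exist[OF this] obtain v :: "nat \<Rightarrow> nat"
    where "inj v \<and> range v \<inter> (F \<union> vars a \<union> vars b \<union> vars c \<union> vars d) = {}" by (rule exE)
  then have inj: "inj v" and v: "range v \<inter> (F \<union> vars a \<union> vars b \<union> vars c \<union> vars d) = {}" by simp_all
  have notin: "v k \<notin> F" "v k \<notin> vars a" "v k \<notin> vars b" "v k \<notin> vars c" "v k \<notin> vars d" for k
    using v by auto
  \<comment> \<open>The length of \<open>T\<close> is the sum of the four lengths, which supplies
    the bound \<open>n\<close> of \<open>disj_append_iff\<close>.\<close>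
  define T where "T = Comp a (Comp b (Comp c d))"
  \<comment> \<open>The variables \<open>v 0\<close> to \<open>v 5\<close> play \<open>X\<close>,
    \<open>Y\<close>, \<open>p\<close>, \<open>q\<close>, \<open>p'\<close>, \<open>q'\<close>, in
    this order; the five components of \<open>s\<close> and \<open>t\<close> are the five equations
    between them.\<close>
  define ds where "ds = [(Exists, v 0, T), (Exists, v 1, T), (Exists, v 2, Var (v 0)),
    (Exists, v 3, Var (v 0)), (Exists, v 4, Var (v 1)), (Exists, v 5, Var (v 1))]"
  define s where "s = pair_tm (Comp (Var (v 0)) ZeroC) (pair_tm (Comp (Var (v 1)) OneC)
    (pair_tm (Comp (Var (v 0)) (Var (v 1))) (pair_tm (Comp a (Var (v 2))) (Comp c (Var (v 4))))))"
  define t where "t = pair_tm (Comp ZeroC (Var (v 0))) (pair_tm (Comp OneC (Var (v 1)))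
    (pair_tm (Comp (Var (v 1)) (Var (v 0))) (pair_tm (Comp (Var (v 3)) b) (Comp (Var (v 5)) d))))"
  have notinT: "v k \<notin> vars T" for k using notin by (simp add: T_def)
  show thesis
  proof (rule that)
    show "fresh F ds" by (auto simp: ds_def notin notinT inj_eq[OF inj])
    show "\<forall>q\<in>set ds. fst q = Exists" by (simp add: ds_def)
    fix \<rho>
    have "sat \<rho> (h (Eq a b) (Eq c d)) \<longleftrightarrow> eval \<rho> a = eval \<rho> b \<or> eval \<rho> c = eval \<rho> d"
      using h by simp
    also have "\<dots> \<longleftrightarrow> sat \<rho> (foldr bquant ds (Eq s t))"
      by (subst disj_append_iff[of _ _ _ _ "length (eval \<rho> T)"], simp add: T_def)
        (simp add: ds_def s_def t_def notin notinT inj_eq[OF inj])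
    finally show "sat \<rho> (foldr bquant ds (Eq s t)) \<longleftrightarrow> sat \<rho> (h (Eq a b) (Eq c d))"
      by (rule sym)
  qed
qed

subsection \<open>Normalizable formulas\<close>

text \<open>The flag \<open>e\<close> forbids universal quantifiers. The variable \<open>z\<close> is prescribed from outside so
  that the matrices of two formulas can share it.\<close>

definition normal_matrix :: "bool \<Rightarrow> nat set \<Rightarrow> nat set \<Rightarrow> nat \<Rightarrow> qprefix \<Rightarrow> tm \<Rightarrow> tm \<Rightarrow> bool" where
  "normal_matrix e V F z qs s t \<longleftrightarrow>
    fresh (insert z F) qs \<and> (e \<longrightarrow> (\<forall>q\<in>set qs. fst q = Exists)) \<and>
    supported (insert z V) (foldr bquant qs (Eq s t)) \<and>
    length_mono z (foldr bquant qs (Eq s t))"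

text \<open>\<open>V\<close> is fixed before \<open>F\<close> and \<open>z\<close>, so a formula can
  be given a new prefix avoiding any finite set, in particular the variables of a matrix it is to be
  merged with.\<close>

definition normalizable :: "bool \<Rightarrow> fm \<Rightarrow> bool" where
  "normalizable e \<phi> \<longleftrightarrow> (\<exists>V. finite V \<and> (\<forall>F z. finite F \<longrightarrow> z \<notin> V \<longrightarrow>
    (\<exists>qs s t. normal_matrix e V F z qs s t \<and>
      (\<forall>\<rho>. sat \<rho> \<phi> \<longleftrightarrow> (\<exists>\<zeta>. sat (\<rho>(z := \<zeta>)) (foldr bquant qs (Eq s t)))))))"

lemma normalizableI:
  assumes "finite V"
    and "\<And>F z. finite F \<Longrightarrow> z \<notin> V \<Longrightarrow> \<exists>qs s t. normal_matrix e V F z qs s t \<and>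
      (\<forall>\<rho>. sat \<rho> \<phi> \<longleftrightarrow> (\<exists>\<zeta>. sat (\<rho>(z := \<zeta>)) (foldr bquant qs (Eq s t))))"
  shows "normalizable e \<phi>"
  using assms unfolding normalizable_def by blast

lemma normalizable_cong:
  "normalizable e \<phi> \<Longrightarrow> (\<And>\<rho>. sat \<rho> \<psi> = sat \<rho> \<phi>) \<Longrightarrow> normalizable e \<psi>"
  by (simp add: normalizable_def)

section \<open>Atomic formulas\<close>

lemma normalizable_Eq: "normalizable e (Eq s t)"
proof (rule normalizableI[of "vars s \<union> vars t"])
  fix F z
  assume z: "z \<notin> vars s \<union> vars t"
  have "supported (insert z (vars s \<union> vars t)) (Eq s t)"
    unfolding supported_def using eval_cong[of s] eval_cong[of t] by (metis UnI1 UnI2 insertCI sat.simps(1))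
  then have "normal_matrix e (vars s \<union> vars t) F z [] s t"
    using z by (simp add: normal_matrix_def length_mono_def)
  moreover have "\<forall>\<rho>. sat \<rho> (Eq s t) \<longleftrightarrow> (\<exists>\<zeta>. sat (\<rho>(z := \<zeta>)) (foldr bquant [] (Eq s t)))"
    using z by simp
  ultimately show "\<exists>qs s' t'. normal_matrix e (vars s \<union> vars t) F z qs s' t' \<and>
      (\<forall>\<rho>. sat \<rho> (Eq s t) \<longleftrightarrow> (\<exists>\<zeta>. sat (\<rho>(z := \<zeta>)) (foldr bquant qs (Eq s' t'))))"
    by blast
qed simp

text \<open>The length of \<open>s\<close> is at most that of \<open>t\<close> exactly when some
  \<open>v\<close> bounded by \<open>t\<close> equals \<open>s\<close>.\<close>

lemma normalizable_Le: "normalizable e (Le s t)"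
proof (rule normalizableI[of "vars s \<union> vars t"])
  fix F z
  assume F: "finite (F :: nat set)" and z: "z \<notin> vars s \<union> vars t"
  obtain v where v: "v \<notin> insert z (F \<union> vars s \<union> vars t)"
    using ex_new_if_finite[OF infinite_UNIV_nat, of "insert z (F \<union> vars s \<union> vars t)"] F by auto
  have sat: "sat \<rho> (foldr bquant [(Exists, v, t)] (Eq (Var v) s)) \<longleftrightarrow> sat \<rho> (Le s t)" for \<rho>
    using v by auto
  have "supported (insert z (vars s \<union> vars t)) (Le s t)"
    unfolding supported_def using eval_cong[of s] eval_cong[of t] by (metis UnI1 UnI2 insertCI sat.simps(2))
  then have "normal_matrix e (vars s \<union> vars t) F z [(Exists, v, t)] (Var v) s"
    using z v unfolding normal_matrix_def supported_def length_mono_def sat by auto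
  moreover have "\<forall>\<rho>. sat \<rho> (Le s t) \<longleftrightarrow> (\<exists>\<zeta>. sat (\<rho>(z := \<zeta>)) (foldr bquant [(Exists, v, t)] (Eq (Var v) s)))"
    using z unfolding sat by simp
  ultimately show "\<exists>qs s' t'. normal_matrix e (vars s \<union> vars t) F z qs s' t' \<and>
      (\<forall>\<rho>. sat \<rho> (Le s t) \<longleftrightarrow> (\<exists>\<zeta>. sat (\<rho>(z := \<zeta>)) (foldr bquant qs (Eq s' t'))))"
    by blast
qed simp

section \<open>Conjunction and disjunction\<close>

lemma supported_combine:
  assumes h: "h = Conj \<or> h = Disj" and "supported V \<phi>" "supported V \<psi>"
  shows "supported V (h \<phi> \<psi>)"
  unfolding supported_def
proof (intro allI impI)
  fix \<rho> \<rho>' :: "nat \<Rightarrow> bitstring"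
  assume "\<forall>x\<in>V. \<rho> x = \<rho>' x"
  then have "sat \<rho> \<phi> = sat \<rho>' \<phi>" "sat \<rho> \<psi> = sat \<rho>' \<psi>"
    using supportedD[OF assms(2), of \<rho> \<rho>'] supportedD[OF assms(3), of \<rho> \<rho>'] by auto
  then show "sat \<rho> (h \<phi> \<psi>) = sat \<rho>' (h \<phi> \<psi>)" using h by auto
qed

lemma length_mono_combine:
  assumes h: "h = Conj \<or> h = Disj" and "length_mono z \<phi>" "length_mono z \<psi>"
  shows "length_mono z (h \<phi> \<psi>)"
  using h
proof
  assume "h = Conj"
  then show ?thesis using assms(2,3) unfolding length_mono_def by (metis sat.simps(4))
next
  assume "h = Disj"
  then show ?thesis using assms(2,3) unfolding length_mono_def by (metis sat.simps(5))
qed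

text \<open>For \<open>Conj\<close>, separate witnesses merge into their concatenation, which is at
  least as long as each.\<close>

lemma ex_combine:
  assumes "h = Conj \<or> h = Disj" "length_mono z \<phi>" "length_mono z \<psi>"
  shows "sat \<rho> (Ex z (h \<phi> \<psi>)) \<longleftrightarrow> sat \<rho> (h (Ex z \<phi>) (Ex z \<psi>))"
  using assms(1)
proof
  assume h: "h = Conj"
  have "\<exists>\<zeta>. sat (\<rho>(z := \<zeta>)) \<phi> \<and> sat (\<rho>(z := \<zeta>)) \<psi>"
    if "sat (\<rho>(z := \<zeta>)) \<phi>" "sat (\<rho>(z := \<zeta>')) \<psi>" for \<zeta> \<zeta>'
    using length_monoD[OF assms(2) that(1), of "\<zeta> @ \<zeta>'"] length_monoD[OF assms(3) that(2), of "\<zeta> @ \<zeta>'"]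
    by auto
  then show ?thesis using h by auto
qed auto

lemma normalizable_combine:
  assumes h: "h = Conj \<or> h = Disj" and "normalizable e \<phi>" "normalizable e \<psi>"
  shows "normalizable e (h \<phi> \<psi>)"
proof -
  obtain V1 where V1: "finite V1" and A: "\<And>F z. finite F \<Longrightarrow> z \<notin> V1 \<Longrightarrow>
      \<exists>qs s t. normal_matrix e V1 F z qs s t \<and>
        (\<forall>\<rho>. sat \<rho> \<phi> \<longleftrightarrow> (\<exists>\<zeta>. sat (\<rho>(z := \<zeta>)) (foldr bquant qs (Eq s t))))"
    using assms(2) unfolding normalizable_def by blast
  obtain V2 where V2: "finite V2" and B: "\<And>F z. finite F \<Longrightarrow> z \<notin> V2 \<Longrightarrow>
      \<exists>qs s t. normal_matrix e V2 F z qs s t \<and>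
        (\<forall>\<rho>. sat \<rho> \<psi> \<longleftrightarrow> (\<exists>\<zeta>. sat (\<rho>(z := \<zeta>)) (foldr bquant qs (Eq s t))))"
    using assms(3) unfolding normalizable_def by blast
  show ?thesis
  proof (rule normalizableI[of "V1 \<union> V2"])
    fix F z
    assume F: "finite (F :: nat set)" and z: "z \<notin> V1 \<union> V2"
    \<comment> \<open>Avoiding \<open>V2\<close> lets \<open>ps\<close> be pulled over the whole
      second matrix.\<close>
    obtain ps a b where M1: "normal_matrix e V1 (F \<union> V2) z ps a b"
      and eq1: "\<And>\<rho>. sat \<rho> \<phi> \<longleftrightarrow> (\<exists>\<zeta>. sat (\<rho>(z := \<zeta>)) (foldr bquant ps (Eq a b)))"
      using A[of "F \<union> V2" z] F V2 z by auto
    \<comment> \<open>Avoiding the variables of \<open>a\<close> and \<open>b\<close> lets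
      \<open>qs\<close> be pulled over the first equation; avoiding \<open>qvars ps\<close> lets it
      follow \<open>ps\<close>.\<close>
    define G where "G = F \<union> qvars ps \<union> vars a \<union> vars b"
    have G: "finite G" using F by (simp add: G_def)
    obtain qs c d where M2: "normal_matrix e V2 G z qs c d"
      and eq2: "\<And>\<rho>. sat \<rho> \<psi> \<longleftrightarrow> (\<exists>\<zeta>. sat (\<rho>(z := \<zeta>)) (foldr bquant qs (Eq c d)))"
      using B[of G z] G z by auto
    obtain ds s t where ds: "fresh (insert z (G \<union> qvars qs)) ds" "\<forall>q\<in>set ds. fst q = Exists"
      and st: "\<And>\<rho>. sat \<rho> (foldr bquant ds (Eq s t)) \<longleftrightarrow> sat \<rho> (h (Eq a b) (Eq c d))"
      using combine_equations[OF h, of "insert z (G \<union> qvars qs)"] G by (metis finite_UnI finite_insert finite_qvars)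
    let ?M1 = "foldr bquant ps (Eq a b)" and ?M2 = "foldr bquant qs (Eq c d)"
    \<comment> \<open>\<open>sat_prefix_pull\<close> extracts the right argument, so the equations
      are swapped before \<open>qs\<close> is pulled out and swapped back afterwards.\<close>
    have comm: "sat \<rho> (h \<alpha> \<beta>) = sat \<rho> (h \<beta> \<alpha>)" for \<rho> \<alpha> \<beta> using h by auto
    have M: "sat \<rho> (foldr bquant (ps @ qs @ ds) (Eq s t)) \<longleftrightarrow> sat \<rho> (h ?M1 ?M2)" for \<rho>
    proof -
      have fq: "fresh (insert z G) qs" and fp: "fresh (insert z (F \<union> V2)) ps"
        and s2: "supported (insert z V2) ?M2"
        using M1 M2 by (auto simp: normal_matrix_def)
      have s1: "supported (insert z G) (Eq a b)"
        unfolding supported_def G_def using eval_cong[of a] eval_cong[of b]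
        by (metis UnI1 UnI2 insertCI sat.simps(1))
      have s2': "supported (insert z (F \<union> V2)) ?M2"
        using s2 by (auto simp: supported_def)
      have "sat \<rho> (foldr bquant (qs @ ds) (Eq s t)) = sat \<rho> (foldr bquant qs (h (Eq c d) (Eq a b)))" for \<rho>
        unfolding foldr_append comp_def by (rule sat_prefix_cong) (simp only: st comm)
      then have "sat \<rho> (foldr bquant (qs @ ds) (Eq s t)) = sat \<rho> (h (Eq a b) ?M2)" for \<rho>
        using sat_prefix_pull[OF h fq s1] by (simp only: comm)
      then have "sat \<rho> (foldr bquant (ps @ qs @ ds) (Eq s t)) = sat \<rho> (foldr bquant ps (h (Eq a b) ?M2))"
        unfolding foldr_append[of _ ps] comp_def by (rule sat_prefix_cong)
      then show ?thesis using sat_prefix_pull[OF h fp s2'] by simp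
    qed
    have "normal_matrix e (V1 \<union> V2) F z (ps @ qs @ ds) s t"
      unfolding normal_matrix_def
    proof (intro conjI)
      have "fresh (insert z G) (qs @ ds)"
        using M2 ds(1) by (intro fresh_append[of _ _ "insert z (G \<union> qvars qs)"]) (auto simp: normal_matrix_def)
      moreover have "fresh (insert z F) ps"
        using M1 by (auto simp: normal_matrix_def elim: fresh_antimono)
      ultimately show "fresh (insert z F) (ps @ qs @ ds)"
        by (intro fresh_append[where F = "insert z F" and G = "insert z G"]) (auto simp: G_def)
      show "e \<longrightarrow> (\<forall>q\<in>set (ps @ qs @ ds). fst q = Exists)"
        using M1 M2 ds(2) by (auto simp: normal_matrix_def)
      have "supported (insert z (V1 \<union> V2)) ?M1" "supported (insert z (V1 \<union> V2)) ?M2"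
        using M1 M2 by (auto simp: normal_matrix_def supported_def)
      then show "supported (insert z (V1 \<union> V2)) (foldr bquant (ps @ qs @ ds) (Eq s t))"
        using supported_combine[OF h, of _ ?M1 ?M2] by (simp only: supported_def M)
      have "length_mono z ?M1" "length_mono z ?M2"
        using M1 M2 by (auto simp: normal_matrix_def)
      then show "length_mono z (foldr bquant (ps @ qs @ ds) (Eq s t))"
        using length_mono_combine[OF h, of z ?M1 ?M2] by (simp only: length_mono_def M)
    qed
    moreover have "\<forall>\<rho>. sat \<rho> (h \<phi> \<psi>) \<longleftrightarrow> (\<exists>\<zeta>. sat (\<rho>(z := \<zeta>)) (foldr bquant (ps @ qs @ ds) (Eq s t)))"
    proof
      fix \<rho>
      have "sat \<rho> (h \<phi> \<psi>) \<longleftrightarrow> sat \<rho> (h (Ex z ?M1) (Ex z ?M2))"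
        using h by (auto simp: eq1 eq2)
      also have "\<dots> \<longleftrightarrow> sat \<rho> (Ex z (h ?M1 ?M2))"
        using M1 M2 by (subst ex_combine[OF h]) (auto simp: normal_matrix_def)
      finally show "sat \<rho> (h \<phi> \<psi>) \<longleftrightarrow> (\<exists>\<zeta>. sat (\<rho>(z := \<zeta>)) (foldr bquant (ps @ qs @ ds) (Eq s t)))"
        by (simp only: M sat.simps)
    qed
    ultimately show "\<exists>qs s t. normal_matrix e (V1 \<union> V2) F z qs s t \<and>
        (\<forall>\<rho>. sat \<rho> (h \<phi> \<psi>) \<longleftrightarrow> (\<exists>\<zeta>. sat (\<rho>(z := \<zeta>)) (foldr bquant qs (Eq s t))))"
      by blast
  qed (simp add: V1 V2)
qed

section \<open>Quantifiers\<close>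

text \<open>A quantified \<open>x\<close> may be a variable that the new prefix has to avoid, so it
  is renamed to \<open>y\<close>. The old matrix does not depend on \<open>y\<close>, hence updating
  \<open>y\<close> after renaming acts like updating \<open>x\<close> before.\<close>

lemma normal_matrix_rename:
  assumes "normal_matrix e V F z qs s t" "x \<in> F" "y \<in> F" "y \<notin> insert z V"
  obtains qs' s' t' where "fresh (insert z F) qs'" "e \<longrightarrow> (\<forall>q\<in>set qs'. fst q = Exists)"
    "\<And>\<rho> \<alpha>. sat (\<rho>(y := \<alpha>)) (foldr bquant qs' (Eq s' t')) \<longleftrightarrow> sat (\<rho>(x := \<alpha>)) (foldr bquant qs (Eq s t))"
proof (rule that)
  have f: "fresh (insert z F) qs" using assms(1) by (simp add: normal_matrix_def)
  then show "fresh (insert z F) (rename_prefix x y qs)"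
    using assms(3) by (simp add: fresh_rename)
  show "e \<longrightarrow> (\<forall>q\<in>set (rename_prefix x y qs). fst q = Exists)"
    using assms(1) by (auto simp: normal_matrix_def split: prod.splits)
  fix \<rho> \<alpha>
  have "sat (\<rho>(y := \<alpha>, x := \<alpha>)) (foldr bquant qs (Eq s t)) \<longleftrightarrow> sat (\<rho>(x := \<alpha>)) (foldr bquant qs (Eq s t))"
    using assms(1,4) by (intro supportedD[of "insert z V"]) (auto simp: normal_matrix_def)
  then show "sat (\<rho>(y := \<alpha>)) (foldr bquant (rename_prefix x y qs) (Eq (rename x y s) (rename x y t)))
      \<longleftrightarrow> sat (\<rho>(x := \<alpha>)) (foldr bquant qs (Eq s t))"
    using sat_rename[OF f, of x y] assms(2,3) by simp
qed

text \<open>The common frame of both quantifier cases: names are settled here, and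
  \<open>correct\<close> retains only the semantic question about a matrix \<open>M\<close> and its
  renamed copy \<open>M'\<close>. The bound is a function of \<open>z\<close> because an unbounded
  quantifier will be bounded by \<open>z\<close> itself.\<close>

lemma normalizable_quantI:
  assumes "normalizable e \<phi>" "finite W"
    and ok: "e \<longrightarrow> Q = Exists"
    and bound: "\<And>z. vars (u z) \<subseteq> insert z W"
    and correct: "\<And>V z M y M'. x \<in> V \<Longrightarrow> W \<subseteq> V \<Longrightarrow> z \<notin> V \<Longrightarrow> supported (insert z V) M \<Longrightarrow> length_mono z M \<Longrightarrow>
      (\<And>\<rho>. sat \<rho> \<phi> \<longleftrightarrow> (\<exists>\<zeta>. sat (\<rho>(z := \<zeta>)) M)) \<Longrightarrow> y \<notin> insert z V \<Longrightarrow>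
      (\<And>\<rho> \<alpha>. sat (\<rho>(y := \<alpha>)) M' \<longleftrightarrow> sat (\<rho>(x := \<alpha>)) M) \<Longrightarrow>
      supported (insert z V) (bquant (Q, y, u z) M') \<and> length_mono z (bquant (Q, y, u z) M') \<and>
      (\<forall>\<rho>. sat \<rho> \<psi> \<longleftrightarrow> (\<exists>\<zeta>. sat (\<rho>(z := \<zeta>)) (bquant (Q, y, u z) M')))"
  shows "normalizable e \<psi>"
proof -
  obtain V where V: "finite V" and A: "\<And>F z. finite F \<Longrightarrow> z \<notin> V \<Longrightarrow>
      \<exists>qs s t. normal_matrix e V F z qs s t \<and>
        (\<forall>\<rho>. sat \<rho> \<phi> \<longleftrightarrow> (\<exists>\<zeta>. sat (\<rho>(z := \<zeta>)) (foldr bquant qs (Eq s t))))"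
    using assms(1) unfolding normalizable_def by blast
  define V' where "V' = insert x (V \<union> W)"
  show ?thesis
  proof (rule normalizableI[of V'])
    show "finite V'" using V assms(2) by (simp add: V'_def)
    fix F z
    assume F: "finite (F :: nat set)" and z: "z \<notin> V'"
    obtain y where y: "y \<notin> insert z (F \<union> V')"
      using ex_new_if_finite[OF infinite_UNIV_nat, of "insert z (F \<union> V')"] F \<open>finite V'\<close> by auto
    \<comment> \<open>Avoiding \<open>y\<close> and \<open>V'\<close> keeps the prefix from binding
      \<open>x\<close>, \<open>y\<close> or a variable of the bound \<open>u z\<close>.\<close>
    obtain qs s t where M: "normal_matrix e V (insert y (F \<union> V')) z qs s t"
      and eq: "\<And>\<rho>. sat \<rho> \<phi> \<longleftrightarrow> (\<exists>\<zeta>. sat (\<rho>(z := \<zeta>)) (foldr bquant qs (Eq s t)))"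
      using A[of "insert y (F \<union> V')" z] F \<open>finite V'\<close> z by (auto simp: V'_def)
    obtain qs' s' t' where qs': "fresh (insert z (insert y (F \<union> V'))) qs'"
        "e \<longrightarrow> (\<forall>q\<in>set qs'. fst q = Exists)"
      and M': "\<And>\<rho> \<alpha>. sat (\<rho>(y := \<alpha>)) (foldr bquant qs' (Eq s' t')) \<longleftrightarrow>
        sat (\<rho>(x := \<alpha>)) (foldr bquant qs (Eq s t))"
      by (rule normal_matrix_rename[OF M, of x y]) (use y in \<open>auto simp: V'_def\<close>)
    have *: "supported (insert z V') (foldr bquant qs (Eq s t))" "length_mono z (foldr bquant qs (Eq s t))"
      using M by (auto simp: normal_matrix_def supported_def V'_def)
    have u: "vars (u z) \<subseteq> insert z V'" using bound[of z] by (auto simp: V'_def)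
    note c = correct[of V' z, OF _ _ z * eq _ M']
    have "fresh (insert z F) ((Q, y, u z) # qs')"
      using y u fresh_antimono[OF qs'(1), of "insert y (insert z F \<union> vars (u z))"] by auto
    then have "normal_matrix e V' F z ((Q, y, u z) # qs') s' t'"
      using c y qs'(2) ok z unfolding normal_matrix_def by (auto simp: V'_def)
    moreover have "\<forall>\<rho>. sat \<rho> \<psi> \<longleftrightarrow> (\<exists>\<zeta>. sat (\<rho>(z := \<zeta>)) (foldr bquant ((Q, y, u z) # qs') (Eq s' t')))"
      using c y by (auto simp: V'_def)
    ultimately show "\<exists>qs s t. normal_matrix e V' F z qs s t \<and>
        (\<forall>\<rho>. sat \<rho> \<psi> \<longleftrightarrow> (\<exists>\<zeta>. sat (\<rho>(z := \<zeta>)) (foldr bquant qs (Eq s t))))"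
      by blast
  qed
qed

text \<open>\<open>x\<close> is bounded by \<open>z\<close>: given values \<alpha> of
  \<open>x\<close> and \<zeta> of \<open>z\<close>, the string \<open>\<zeta> @ \<alpha>\<close> is
  long enough to bound \<alpha> and, by monotonicity, still satisfies the matrix.\<close>

lemma normalizable_Ex:
  assumes "normalizable e \<phi>"
  shows "normalizable e (Ex x \<phi>)"
proof (rule normalizable_quantI[OF assms, of "{}" Exists Var x])
  fix V z M y M'
  assume x: "x \<in> V" and z: "z \<notin> V" and s: "supported (insert z V) M" and m: "length_mono z M"
    and eq: "\<And>\<rho>. sat \<rho> \<phi> \<longleftrightarrow> (\<exists>\<zeta>. sat (\<rho>(z := \<zeta>)) M)" and y: "y \<notin> insert z V"
    and M': "\<And>\<rho> \<alpha>. sat (\<rho>(y := \<alpha>)) M' \<longleftrightarrow> sat (\<rho>(x := \<alpha>)) M"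
  have xz: "x \<noteq> z" using x z by auto
  have sat: "sat \<rho> (bquant (Exists, y, Var z) M') \<longleftrightarrow> (\<exists>\<alpha>. length \<alpha> \<le> length (\<rho> z) \<and> sat (\<rho>(x := \<alpha>)) M)" for \<rho>
    using y by (auto simp: M')
  have "supported (insert z V) (bquant (Exists, y, Var z) M')"
    unfolding supported_def sat
  proof (intro allI impI)
    fix \<rho> \<rho>' :: "nat \<Rightarrow> bitstring"
    assume "\<forall>x\<in>insert z V. \<rho> x = \<rho>' x"
    moreover from this have "sat (\<rho>(x := \<alpha>)) M = sat (\<rho>'(x := \<alpha>)) M" for \<alpha>
      by (intro supportedD[OF s]) auto
    ultimately show "(\<exists>\<alpha>. length \<alpha> \<le> length (\<rho> z) \<and> sat (\<rho>(x := \<alpha>)) M) =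
        (\<exists>\<alpha>. length \<alpha> \<le> length (\<rho>' z) \<and> sat (\<rho>'(x := \<alpha>)) M)"
      by simp
  qed
  \<comment> \<open>A longer \<open>z\<close> widens the range of \<alpha> and keeps
    \<open>M\<close> true.\<close>
  moreover have "length_mono z (bquant (Exists, y, Var z) M')"
    unfolding length_mono_def sat
    using m xz by (auto simp: fun_upd_twist intro: length_monoD order_trans)
  moreover have "sat \<rho> (Ex x \<phi>) \<longleftrightarrow> (\<exists>\<zeta>. sat (\<rho>(z := \<zeta>)) (bquant (Exists, y, Var z) M'))" for \<rho>
  proof -
    have "\<exists>\<zeta>' \<alpha>. length \<alpha> \<le> length \<zeta>' \<and> sat (\<rho>(x := \<alpha>, z := \<zeta>')) M"
      if "sat (\<rho>(x := \<alpha>, z := \<zeta>)) M" for \<alpha> \<zeta>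
      using length_monoD[OF m that, of "\<zeta> @ \<alpha>"] by (intro exI[of _ "\<zeta> @ \<alpha>"] exI[of _ \<alpha>]) simp
    then show ?thesis
      unfolding sat using xz by (auto simp: eq fun_upd_twist)
  qed
  ultimately show "supported (insert z V) (bquant (Exists, y, Var z) M') \<and>
      length_mono z (bquant (Exists, y, Var z) M') \<and>
      (\<forall>\<rho>. sat \<rho> (Ex x \<phi>) \<longleftrightarrow> (\<exists>\<zeta>. sat (\<rho>(z := \<zeta>)) (bquant (Exists, y, Var z) M')))"
    by blast
qed auto

text \<open>A collection argument: choose a witness for each of the finitely many \<alpha>; by
  monotonicity, one string longer than all of them serves every \<alpha>.\<close>

lemma normalizable_BAll:
  assumes "normalizable False \<phi>" and xt: "x \<notin> vars t"
  shows "normalizable False (BAll x t \<phi>)"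
proof (rule normalizable_quantI[OF assms(1), of "vars t" Forall "\<lambda>_. t" x])
  fix V z M y M'
  assume x: "x \<in> V" and W: "vars t \<subseteq> V" and z: "z \<notin> V" and s: "supported (insert z V) M"
    and m: "length_mono z M"
    and eq: "\<And>\<rho>. sat \<rho> \<phi> \<longleftrightarrow> (\<exists>\<zeta>. sat (\<rho>(z := \<zeta>)) M)" and y: "y \<notin> insert z V"
    and M': "\<And>\<rho> \<alpha>. sat (\<rho>(y := \<alpha>)) M' \<longleftrightarrow> sat (\<rho>(x := \<alpha>)) M"
  have xz: "x \<noteq> z" and zt: "z \<notin> vars t" and yt: "y \<notin> vars t" using x z y W by auto
  have sat: "sat \<rho> (bquant (Forall, y, t) M') \<longleftrightarrow>
      (\<forall>\<alpha>. length \<alpha> \<le> length (eval \<rho> t) \<longrightarrow> sat (\<rho>(x := \<alpha>)) M)" for \<rho>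
    using yt by (simp add: M')
  have "supported (insert z V) (bquant (Forall, y, t) M')"
    unfolding supported_def sat
  proof (intro allI impI)
    fix \<rho> \<rho>' :: "nat \<Rightarrow> bitstring"
    assume *: "\<forall>x\<in>insert z V. \<rho> x = \<rho>' x"
    then have "sat (\<rho>(x := \<alpha>)) M = sat (\<rho>'(x := \<alpha>)) M" for \<alpha>
      by (intro supportedD[OF s]) auto
    moreover have "eval \<rho> t = eval \<rho>' t" using * W by (intro eval_cong) auto
    ultimately show "(\<forall>\<alpha>. length \<alpha> \<le> length (eval \<rho> t) \<longrightarrow> sat (\<rho>(x := \<alpha>)) M) =
        (\<forall>\<alpha>. length \<alpha> \<le> length (eval \<rho>' t) \<longrightarrow> sat (\<rho>'(x := \<alpha>)) M)"
      by simp
  qed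
  \<comment> \<open>Since \<open>z\<close> does not occur in \<open>t\<close>, lengthening
    \<open>z\<close> does not enlarge the range of the universal quantifier.\<close>
  moreover have "length_mono z (bquant (Forall, y, t) M')"
    unfolding length_mono_def sat
    using m xz zt by (auto simp: fun_upd_twist intro: length_monoD)
  moreover have "sat \<rho> (BAll x t \<phi>) \<longleftrightarrow> (\<exists>\<zeta>. sat (\<rho>(z := \<zeta>)) (bquant (Forall, y, t) M'))" for \<rho>
  proof -
    define S :: "bitstring set" where "S = {\<alpha>. length \<alpha> \<le> length (eval \<rho> t)}"
    have S: "finite S"
      using finite_lists_length_le[of "UNIV :: bool set" "length (eval \<rho> t)"] by (simp add: S_def)
    have "\<exists>\<zeta>. \<forall>\<alpha>\<in>S. sat (\<rho>(x := \<alpha>, z := \<zeta>)) M" if all: "\<forall>\<alpha>\<in>S. \<exists>\<zeta>. sat (\<rho>(x := \<alpha>, z := \<zeta>)) M"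
    proof -
      obtain f where f: "\<And>\<alpha>. \<alpha> \<in> S \<Longrightarrow> sat (\<rho>(x := \<alpha>, z := f \<alpha>)) M"
        using all by metis
      obtain n where n: "\<And>\<alpha>. \<alpha> \<in> S \<Longrightarrow> length (f \<alpha>) < n"
        using finite_imageI[OF S, of "\<lambda>\<alpha>. length (f \<alpha>)"] unfolding finite_nat_set_iff_bounded by auto
      have "sat (\<rho>(x := \<alpha>, z := replicate n False)) M" if "\<alpha> \<in> S" for \<alpha>
        using length_monoD[OF m f[OF that]] n[OF that] by simp
      then show ?thesis by blast
    qed
    then show ?thesis
      unfolding sat using xz xt zt by (auto simp: eq fun_upd_twist S_def)
  qed
  ultimately show "supported (insert z V) (bquant (Forall, y, t) M') \<and>
      length_mono z (bquant (Forall, y, t) M') \<and>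
      (\<forall>\<rho>. sat \<rho> (BAll x t \<phi>) \<longleftrightarrow> (\<exists>\<zeta>. sat (\<rho>(z := \<zeta>)) (bquant (Forall, y, t) M')))"
    by blast
qed auto

section \<open>Negated atoms, and all Sigma-formulas\<close>

text \<open>A strict inequality of lengths is a weak one after appending a letter to the shorter
  side.\<close>

lemma normalizable_Neg_Le: "normalizable e (Neg (Le s t))"
  by (rule normalizable_cong[OF normalizable_Le[of e "Comp t ZeroC" s]]) auto

text \<open>Distinct strings of equal length share a prefix followed by different letters. This
  positive description replaces the negated equation.\<close>

lemma neq_list_iff:
  fixes a b :: "bool list"
  shows "a \<noteq> b \<longleftrightarrow> length a < length b \<or> length b < length a \<or>
    (\<exists>x y w. a = x @ False # y \<and> b = x @ True # w \<or> a = x @ True # y \<and> b = x @ False # w)"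
  (is "_ \<longleftrightarrow> ?r")
proof
  assume "a \<noteq> b"
  show ?r
  proof (cases "length a = length b")
    case True
    then obtain x p y q w where "p \<noteq> q" "a = x @ [p] @ y" "b = x @ [q] @ w"
      using same_length_different[OF \<open>a \<noteq> b\<close>] by blast
    then show ?thesis by (cases p; cases q) auto
  qed auto
qed auto

lemma normalizable_Neg_Eq: "normalizable e (Neg (Eq s t))"
proof -
  have "finite (vars s \<union> vars t)" by simp
  from fresh_variables_exist[OF this] obtain v :: "nat \<Rightarrow> nat"
    where "inj v \<and> range v \<inter> (vars s \<union> vars t) = {}" by (rule exE)
  then have inj: "inj v" and v: "range v \<inter> (vars s \<union> vars t) = {}" by simp_all
  have notin: "v k \<notin> vars s" "v k \<notin> vars t" for k
    using v by auto
  \<comment> \<open>\<open>v 0\<close> is the common prefix, \<open>c\<close> the letter where the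
    strings differ, and \<open>v k\<close> the remainder.\<close>
  define word where "word c k = Comp (Var (v 0)) (Comp c (Var (v k)))" for c k
  define differ where "differ = Ex (v 0) (Ex (v 1) (Ex (v 2)
    (Disj (Conj (Eq s (word ZeroC 1)) (Eq t (word OneC 2)))
      (Conj (Eq s (word OneC 1)) (Eq t (word ZeroC 2))))))"
  have differ: "sat \<rho> differ \<longleftrightarrow> (\<exists>x y w. eval \<rho> s = x @ False # y \<and> eval \<rho> t = x @ True # w \<or>
      eval \<rho> s = x @ True # y \<and> eval \<rho> t = x @ False # w)" for \<rho>
    by (simp add: differ_def word_def notin inj_eq[OF inj])
  have "normalizable e (Disj (Neg (Le t s)) (Disj (Neg (Le s t)) differ))"
    unfolding differ_def
    by (intro normalizable_combine[of Conj] normalizable_combine[of Disj] normalizable_Ex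
        normalizable_Neg_Le normalizable_Eq) simp_all
  then show ?thesis
  proof (rule normalizable_cong)
    show "sat \<rho> (Neg (Eq s t)) = sat \<rho> (Disj (Neg (Le t s)) (Disj (Neg (Le s t)) differ))" for \<rho>
      using neq_list_iff[of "eval \<rho> s" "eval \<rho> t"] by (simp add: differ not_le)
  qed
qed

text \<open>A bounded existential quantifier unfolds to \<open>Ex\<close> over a conjunction, so it
  falls under earlier cases. A bounded universal one is its own subformula, which forces
  \<open>e\<close> to be false.\<close>

lemma normalizable_Sigma:
  "Sigma_fm \<phi> \<Longrightarrow> e \<longrightarrow> (\<forall>x t \<psi>. BAll x t \<psi> \<notin> subformulas \<phi>) \<Longrightarrow> normalizable e \<phi>"
proof (induction rule: Sigma_fm.induct)
  case (BEx \<phi> x t)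
  then show ?case
    unfolding BEx_def
    by (intro normalizable_Ex normalizable_combine[of Conj] normalizable_Le) auto
next
  case (BAll \<phi> x t)
  have "BAll x t \<phi> \<in> subformulas (BAll x t \<phi>)" by (simp add: BAll_def)
  then have "\<not> e" using BAll.prems by blast
  then show ?case using BAll normalizable_BAll by simp
qed (auto intro!: normalizable_Le normalizable_Neg_Le normalizable_Eq normalizable_Neg_Eq
      normalizable_combine[of Conj] normalizable_combine[of Disj] normalizable_Ex)

subsection \<open>The two normal forms\<close>

lemma sat_foldr_Ex_Conj_Le:
  "set vs \<inter> (vars a \<union> vars b) = {} \<Longrightarrow>
    sat \<rho> (foldr Ex vs (Conj (Le a b) \<phi>)) \<longleftrightarrow> sat \<rho> (Le a b) \<and> sat \<rho> (foldr Ex vs \<phi>)"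
  by (induction vs arbitrary: \<rho>) auto

text \<open>All bounds can move behind the block of quantifiers because later variables do not occur
  in earlier bounds.\<close>

lemma sat_prefix_existential:
  "fresh F qs \<Longrightarrow> \<forall>q\<in>set qs. fst q = Exists \<Longrightarrow>
    sat \<rho> (foldr bquant qs \<phi>) \<longleftrightarrow>
    sat \<rho> (foldr Ex (bvars qs) (foldr Conj (map (\<lambda>(v, u). Le (Var v) u) (map snd qs)) \<phi>))"
proof (induction F qs arbitrary: \<rho> rule: fresh.induct)
  case (2 F Q v u qs)
  have "set (bvars qs) \<inter> (vars (Var v) \<union> vars u) = {}"
    using 2 fresh_disjoint[of "insert v (F \<union> vars u)" qs] by auto
  note pull = sat_foldr_Ex_Conj_Le[OF this]
  show ?case
    using 2 by (auto simp: pull simp del: vars.simps)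
qed simp

theorem theorem9:
  fixes \<phi> :: fm
  assumes "Sigma_fm \<phi>"
  shows "(\<exists>\<psi>. bounded_prefix_form \<psi> \<and> equiv_F \<phi> \<psi>) \<and>
         (purely_existential \<phi> \<longrightarrow> (\<exists>\<psi>. existential_form \<psi> \<and> equiv_F \<phi> \<psi>))"
proof -
  have normal: "\<exists>z qs s t. fresh {z} qs \<and> (e \<longrightarrow> (\<forall>q\<in>set qs. fst q = Exists)) \<and>
      (\<forall>\<rho>. sat \<rho> \<phi> \<longleftrightarrow> sat \<rho> (Ex z (foldr bquant qs (Eq s t))))" if ne: "normalizable e \<phi>" for e
  proof -
    obtain V where "finite V" and V: "\<And>F z. finite F \<Longrightarrow> z \<notin> V \<Longrightarrow>
        \<exists>qs s t. normal_matrix e V F z qs s t \<and>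
          (\<forall>\<rho>. sat \<rho> \<phi> \<longleftrightarrow> (\<exists>\<zeta>. sat (\<rho>(z := \<zeta>)) (foldr bquant qs (Eq s t))))"
      using ne unfolding normalizable_def by blast
    obtain z where "z \<notin> V" using ex_new_if_finite[OF infinite_UNIV_nat \<open>finite V\<close>] by blast
    \<comment> \<open>With nothing left to merge, \<open>F\<close> is empty; the bound variables are
      still distinct from each other and from \<open>z\<close>.\<close>
    then show ?thesis using V[of "{}" z] unfolding normal_matrix_def by auto
  qed
  have dist: "distinct (z # bvars qs)" if "fresh {z} qs" for z qs
    using fresh_distinct[OF that] fresh_disjoint[OF that] by auto
  obtain z qs s t where 1: "fresh {z} qs" "\<And>\<rho>. sat \<rho> \<phi> \<longleftrightarrow> sat \<rho> (Ex z (foldr bquant qs (Eq s t)))"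
    using normal[of False] normalizable_Sigma[OF assms, of False] by auto
  have "bounded_prefix_form (Ex z (foldr bquant qs (Eq s t)))"
    unfolding bounded_prefix_form_def using dist[OF 1(1)] fresh_bound[OF 1(1)] by blast
  moreover have "equiv_F \<phi> (Ex z (foldr bquant qs (Eq s t)))"
    by (simp add: equiv_F_def Iff_def 1(2))
  moreover have "\<exists>\<psi>. existential_form \<psi> \<and> equiv_F \<phi> \<psi>" if "purely_existential \<phi>"
  proof -
    have "normalizable True \<phi>"
      using normalizable_Sigma[OF assms] that by (simp add: purely_existential_def)
    then obtain z qs s t where 2: "fresh {z} qs" "\<forall>q\<in>set qs. fst q = Exists"
      "\<And>\<rho>. sat \<rho> \<phi> \<longleftrightarrow> sat \<rho> (Ex z (foldr bquant qs (Eq s t)))"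
      using normal[of True] by auto
    \<comment> \<open>All quantifiers of \<open>qs\<close> are existential here, so only variables
      and bounds are kept.\<close>
    define bs where "bs = map snd qs"
    define \<psi> where "\<psi> = foldr Ex (z # map fst bs) (foldr Conj (map (\<lambda>(v, u). Le (Var v) u) bs) (Eq s t))"
    have bv: "bvars qs = map fst bs" by (auto simp: bs_def)
    have "\<forall>(v, u)\<in>set bs. v \<notin> vars u"
      using fresh_bound[OF 2(1)] by (auto simp: bs_def)
    then have "existential_form \<psi>"
      unfolding existential_form_def \<psi>_def using dist[OF 2(1)] bv by metis
    moreover have "equiv_F \<phi> \<psi>"
      using sat_prefix_existential[OF 2(1,2)] by (simp add: equiv_F_def Iff_def 2(3) \<psi>_def bv flip: bs_def)
    ultimately show ?thesis by blast
  qed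
  ultimately show ?thesis by blast
qed

end
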